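(* Let $X$ be a regular curve and let $f:X\to X$ be a continuous map. Then $$h_{\mathrm{pol}}(f)\leqslant 1+\limsup_{n\to\infty}\frac{\log \varphi(f,n)}{\log n},$$ where $\varphi(f,n)=\sup_{x\in X}|\mathrm{Comp}(f^{-n}(x))|$.
   Context: A continuum is a nonempty connected compact metric space. A continuum $X$ is a regular curve if for each $x\in X$ and each open neighbourhood $U$ of $x$ in $X$ there exists an open neighbourhood $V$ of $x$ in $X$ such that $V\subset U$ and the boundary $\partial V$ is finite. Polynomial entropy: let $(X,d)$ be a compact metric space and $f:X\to X$ continuous. For $n\geq 1$ put $d_n^f(x,y)=\max_{0\leq k\leq n-1}d(f^k(x),f^k(y))$. For $\varepsilon>0$, a finite set $E\subset X$ is $(n,\varepsilon)$-separated if $d_n^f(x,y)\geq\varepsilon$ for all distinct $x,y\in E$; $\mathrm{sep}(n,\varepsilon)$ denotes the maximal cardinality of an $(n,\varepsilon)$-separated subset of $X$. Then $$h_{\mathrm{pol}}(f)=\lim_{\varepsilon\to 0}\limsup_{n\to\infty}\frac{\log \mathrm{sep}(n,\varepsilon)}{\log n}.$$ For a space $Z$, $\mathrm{Comp}(Z)$ is the set of connected components of $Z$, and $|A|$ denotes the cardinality of a set $A$. Here $f^{-n}(x)=(f^n)^{-1}(\{x\})$ with the subspace topology. The supremum $\varphi(f,n)$ may be $+\infty$, with $\log(+\infty)=+\infty$. *)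

theory Defs
  imports "HOL-Analysis.Analysis"
begin

text \<open>Spaces are subsets of a metric space type, with the subspace topology and metric. A continuum
  that consists of a single point is allowed.\<close>

definition continuum :: "'a::metric_space set \<Rightarrow> bool" where
  "continuum X \<longleftrightarrow> X \<noteq> {} \<and> connected X \<and> compact X"

definition regular_curve :: "'a::metric_space set \<Rightarrow> bool" where
  "regular_curve X \<longleftrightarrow> continuum X \<and>
     (\<forall>x\<in>X. \<forall>U. openin (top_of_set X) U \<and> x \<in> U \<longrightarrow>
        (\<exists>V. openin (top_of_set X) V \<and> x \<in> V \<and> V \<subseteq> U \<and> finite (top_of_set X frontier_of V)))"

text \<open>The Bowen metric is meant for \<open>n \<ge> 1\<close>; for \<open>n = 0\<close> its value is unspecified, which does not
  affect upper limits as \<open>n\<close> tends to infinity.\<close>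

definition bowen_dist :: "('a::metric_space \<Rightarrow> 'a) \<Rightarrow> nat \<Rightarrow> 'a \<Rightarrow> 'a \<Rightarrow> real" where
  "bowen_dist f n x y = (MAX k\<in>{..<n}. dist ((f ^^ k) x) ((f ^^ k) y))"

definition separated :: "('a::metric_space \<Rightarrow> 'a) \<Rightarrow> nat \<Rightarrow> real \<Rightarrow> 'a set \<Rightarrow> bool" where
  "separated f n \<epsilon> E \<longleftrightarrow> finite E \<and> (\<forall>x\<in>E. \<forall>y\<in>E. x \<noteq> y \<longrightarrow> bowen_dist f n x y \<ge> \<epsilon>)"

text \<open>The supremum below is a finite maximum if \<open>X\<close> is compact, \<open>f\<close> is a continuous self-map of \<open>X\<close>,
  \<open>n \<ge> 1\<close> and \<open>\<epsilon> > 0\<close>; see \<open>sep_is_max\<close>.\<close>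

definition sep :: "'a::metric_space set \<Rightarrow> ('a \<Rightarrow> 'a) \<Rightarrow> nat \<Rightarrow> real \<Rightarrow> enat" where
  "sep X f n \<epsilon> = (SUP E\<in>{E. E \<subseteq> X \<and> separated f n \<epsilon> E}. enat (card E))"

definition ln_enat :: "enat \<Rightarrow> ereal" where
  "ln_enat m = (case m of enat k \<Rightarrow> if k = 0 then -\<infinity> else ereal (ln (real k)) | \<infinity> \<Rightarrow> \<infinity>)"

definition growth_rate :: "(nat \<Rightarrow> enat) \<Rightarrow> ereal" where
  "growth_rate a = limsup (\<lambda>n. ln_enat (a n) / ereal (ln (real n)))"

text \<open>The limit as \<open>\<epsilon>\<close> tends to \<open>0\<close> from the right always exists; see \<open>pol_entropy_tendsto\<close>.\<close>

definition pol_entropy :: "'a::metric_space set \<Rightarrow> ('a \<Rightarrow> 'a) \<Rightarrow> ereal" where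
  "pol_entropy X f = Lim (at_right 0) (\<lambda>\<epsilon>. growth_rate (\<lambda>n. sep X f n \<epsilon>))"

definition cardinality :: "'b set \<Rightarrow> enat" where
  "cardinality A = (if finite A then enat (card A) else \<infinity>)"

definition phi :: "'a::metric_space set \<Rightarrow> ('a \<Rightarrow> 'a) \<Rightarrow> nat \<Rightarrow> enat" where
  "phi X f n = (SUP x\<in>X. cardinality (components {y\<in>X. (f ^^ n) y = x}))"

lemma ln_enat_mono: "a \<le> b \<Longrightarrow> ln_enat a \<le> ln_enat b"
  by (cases a; cases b) (auto simp: ln_enat_def)

lemma sep_antimono: "\<epsilon> \<le> \<delta> \<Longrightarrow> sep X f n \<delta> \<le> sep X f n \<epsilon>"
  unfolding sep_def by (rule SUP_subset_mono) (auto simp: separated_def intro: order_trans)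

lemma growth_rate_mono:
  assumes "\<And>n. a n \<le> b n"
  shows "growth_rate a \<le> growth_rate b"
  unfolding growth_rate_def
proof (rule Limsup_mono)
  show "\<forall>\<^sub>F n in sequentially. ln_enat (a n) / ereal (ln (real n)) \<le> ln_enat (b n) / ereal (ln (real n))"
    using eventually_gt_at_top[of 1]
  proof eventually_elim
    case (elim n)
    then have "ln (real n) > 0" by simp
    then show ?case
      by (intro ereal_divide_right_mono ln_enat_mono assms) auto
  qed
qed

lemma pol_entropy_tendsto:
  "((\<lambda>\<epsilon>. growth_rate (\<lambda>n. sep X f n \<epsilon>)) \<longlongrightarrow> pol_entropy X f) (at_right 0)"
proof -
  define g where "g = (\<lambda>\<epsilon>. growth_rate (\<lambda>n. sep X f n \<epsilon>))"
  have anti: "g \<delta> \<le> g \<epsilon>" if "\<epsilon> \<le> \<delta>" for \<epsilon> \<delta>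
    unfolding g_def by (intro growth_rate_mono sep_antimono that)
  have "(g \<longlongrightarrow> (SUP \<epsilon>\<in>{0<..}. g \<epsilon>)) (at_right 0)"
  proof (rule increasing_tendsto)
    show "\<forall>\<^sub>F \<epsilon> in at_right 0. g \<epsilon> \<le> (SUP \<epsilon>\<in>{0<..}. g \<epsilon>)"
      using eventually_at_right_less[of "0::real"] by eventually_elim (auto intro: SUP_upper)
    fix c assume "c < (SUP \<epsilon>\<in>{0<..}. g \<epsilon>)"
    then obtain \<delta> where \<delta>: "\<delta> > 0" "c < g \<delta>" by (auto simp: less_SUP_iff)
    have "\<forall>\<^sub>F \<epsilon> in at_right 0. \<epsilon> \<in> {0<..<\<delta>}"
      by (rule eventually_at_right_real[OF \<delta>(1)])
    then show "\<forall>\<^sub>F \<epsilon> in at_right 0. c < g \<epsilon>"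
    proof eventually_elim
      case (elim \<epsilon>)
      then show ?case using \<delta>(2) anti[of \<epsilon> \<delta>] by auto
    qed
  qed
  then show ?thesis
    using tendsto_Lim[of "at_right (0::real)" g] unfolding pol_entropy_def g_def by auto
qed

lemma sep_is_max:
  fixes X :: "'a::metric_space set"
  assumes "compact X" and cont: "continuous_on X f" and self: "f \<in> X \<rightarrow> X"
    and "n \<ge> 1" "\<epsilon> > 0"
  shows "\<exists>E. E \<subseteq> X \<and> separated f n \<epsilon> E \<and> sep X f n \<epsilon> = enat (card E)"
proof -
  have maps: "(f ^^ k) ` X \<subseteq> X" for k
    using self by (induction k) auto
  have contk: "continuous_on X (f ^^ k)" for k
  proof (induction k)
    case (Suc k)
    have "continuous_on X (f \<circ> (f ^^ k))"
      by (rule continuous_on_compose[OF Suc continuous_on_subset[OF cont maps]])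
    then show ?case by simp
  qed (auto simp: id_def)
  have "\<exists>d>0. \<forall>x\<in>X. \<forall>y\<in>X. dist x y < d \<longrightarrow> dist ((f ^^ k) x) ((f ^^ k) y) < \<epsilon>" for k
    using compact_uniformly_continuous[OF contk[of k] \<open>compact X\<close>] \<open>\<epsilon> > 0\<close>
    unfolding uniformly_continuous_on_def by (metis dist_commute)
  then obtain d where d: "\<And>k. d k > 0"
    "\<And>k x y. x \<in> X \<Longrightarrow> y \<in> X \<Longrightarrow> dist x y < d k \<Longrightarrow> dist ((f ^^ k) x) ((f ^^ k) y) < \<epsilon>"
    by metis
  have ne: "{..<n} \<noteq> {}" using \<open>n \<ge> 1\<close> by (auto simp: lessThan_empty_iff)
  define \<delta> where "\<delta> = (MIN k\<in>{..<n}. d k)"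
  have "\<delta> > 0" unfolding \<delta>_def using d(1) ne by (subst Min_gr_iff) auto
  have close: "bowen_dist f n x y < \<epsilon>" if "x \<in> X" "y \<in> X" "dist x y < \<delta>" for x y
  proof -
    have "dist ((f ^^ k) x) ((f ^^ k) y) < \<epsilon>" if "k < n" for k
    proof -
      have "\<delta> \<le> d k" unfolding \<delta>_def using that by (intro Min_le) auto
      then show ?thesis using d(2)[OF \<open>x \<in> X\<close> \<open>y \<in> X\<close>] \<open>dist x y < \<delta>\<close> by auto
    qed
    then show ?thesis
      unfolding bowen_dist_def using ne by (subst Max_less_iff) auto
  qed
  obtain K where K: "finite K" "X \<subseteq> (\<Union>x\<in>K. ball x (\<delta>/2))"
    using compactE_image[of X X "\<lambda>x. ball x (\<delta>/2)"] \<open>compact X\<close> \<open>\<delta> > 0\<close>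
    by (metis UN_I centre_in_ball half_gt_zero open_ball subsetI)
  have bound: "card E \<le> card K" if E: "E \<subseteq> X" "separated f n \<epsilon> E" for E
  proof -
    have "\<forall>x\<in>E. \<exists>c\<in>K. dist c x < \<delta>/2" using K(2) E(1) by (auto simp: subset_iff)
    then obtain c where c: "\<And>x. x \<in> E \<Longrightarrow> c x \<in> K \<and> dist (c x) x < \<delta>/2" by metis
    have "inj_on c E"
    proof (rule inj_onI, rule ccontr)
      fix x y assume xy: "x \<in> E" "y \<in> E" "c x = c y" "x \<noteq> y"
      have "dist x y < \<delta>" using dist_triangle_half_r[of "c x" x \<delta> y] c[of x] c[of y] xy by metis
      then have "bowen_dist f n x y < \<epsilon>" using close E(1) xy(1,2) by blast
      moreover have "\<epsilon> \<le> bowen_dist f n x y" using E(2) xy unfolding separated_def by blast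
      ultimately show False by simp
    qed
    then show ?thesis using c K(1) by (intro card_inj_on_le[of c]) auto
  qed
  define M where "M = {E. E \<subseteq> X \<and> separated f n \<epsilon> E}"
  have "card ` M \<subseteq> {..card K}" using bound by (auto simp: M_def)
  then have fin: "finite (card ` M)" by (rule finite_subset) simp
  have "{} \<in> M" by (simp add: M_def separated_def)
  then have "card ` M \<noteq> {}" by blast
  with fin have "Max (card ` M) \<in> card ` M" by (rule Max_in)
  then obtain E where E: "E \<in> M" "card E = Max (card ` M)" by force
  have "sep X f n \<epsilon> = enat (card E)"
    unfolding sep_def M_def[symmetric]
  proof (rule antisym)
    show "(SUP E\<in>M. enat (card E)) \<le> enat (card E)"
    proof (rule SUP_least)
      fix F assume "F \<in> M"
      then have "card F \<le> Max (card ` M)" using fin by (intro Max_ge) blast+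
      then show "enat (card F) \<le> enat (card E)" using E(2) by simp
    qed
    show "enat (card E) \<le> (SUP E\<in>M. enat (card E))"
      using E(1) by (rule SUP_upper)
  qed
  with E(1) show ?thesis unfolding M_def by blast
qed

end

theory Submission
  imports Defs
begin

text \<open>
  A regular curve falls into connected pieces of diameter at most \<open>\<epsilon>\<close> once a suitable finite set
  \<open>F\<close> is removed (\<open>regular_curve_finite_cut\<close>). The orbit of a point \<open>x\<close> during the times \<open>j < n\<close>
  is therefore known up to \<open>\<epsilon>\<close> by the pieces that contain its points. Let \<open>H\<close> be the closed set of all
  points whose orbit meets \<open>F\<close> before time \<open>n\<close>, suppose that \<open>x\<close> is not in \<open>H\<close>, and let \<open>D\<close> be the
  component of \<open>x\<close> in the complement of \<open>H\<close>. Every \<open>f ^^ j\<close> with \<open>j < n\<close> maps \<open>D\<close> into one piece,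
  and unless \<open>H\<close> is empty, the closure of \<open>D\<close> contains a point \<open>z\<close> of \<open>H\<close> by boundary bumping; \<open>z\<close> is
  carried into \<open>F\<close> at some time \<open>i < n\<close>. So the points of the preimages \<open>(f ^^ i) -` F\<close> shadow all
  orbits, and if \<open>f\<close> is injective there are at most \<open>n * card F\<close> of them. If \<open>H\<close> is empty, any single
  point shadows all orbits.

  In general these preimages are infinite, and only their components can be counted: there are at most
  \<open>card F * \<phi>(f, i)\<close> for each \<open>i\<close>. One representative from each component is still enough. On the
  component \<open>C\<close> of \<open>z\<close> in its fibre of \<open>f ^^ i\<close>, all iterates from time \<open>i\<close> on are constant, so within
  \<open>C\<close> only the times before \<open>i\<close> matter, and the same argument applies inside \<open>C\<close> with \<open>i\<close> in place
  of \<open>n\<close>. The times strictly decrease, so the descent ends. No error accumulates if \<open>i\<close> is always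
  chosen as the first visit to \<open>F\<close>: before that time the orbit of \<open>z\<close> stays in the very pieces visited
  by \<open>x\<close>, and from that time on it is not changed any more. This is \<open>shadowing_within_continuum\<close>, the
  core of the proof.

  Two points of an \<open>(n, \<delta>)\<close>-separated set with the same representative would be within
  distance \<open>2 * \<epsilon> < \<delta>\<close> at all times before \<open>n\<close>, so there are at most \<open>1 + \<Sum>i<n. card F * \<phi>(f, i)\<close> separated points. If
  \<open>\<phi>(f, i) \<le> i powr s\<close>, this is of order \<open>n powr (1 + s)\<close>, which is the bound that is sought.

  The growth rate of \<open>\<phi>\<close> says nothing about small \<open>i\<close>, where \<open>\<phi>\<close> may even be infinite. Hence only
  the times \<open>m \<le> j < n\<close> are shadowed, for a fixed \<open>m\<close>. Separated points with a common
  representative are then separated at a time before \<open>m\<close>, so each class has a number of points that is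
  bounded independently of \<open>n\<close> (\<open>card_separated_le_transversal\<close>).
\<close>

section \<open>Cutting continua\<close>

text \<open>The set \<open>F\<close> consists of the finite boundaries of the members of a finite cover by small sets: a
  connected set that avoids the boundary of a member which it meets lies inside that member.\<close>

lemma regular_curve_finite_cut:
  fixes X :: "'a::metric_space set"
  assumes "regular_curve X" and "\<epsilon> > 0"
  obtains F where "finite F" "F \<subseteq> X"
    "\<And>S u v. connected S \<Longrightarrow> S \<subseteq> X - F \<Longrightarrow> u \<in> S \<Longrightarrow> v \<in> S \<Longrightarrow> dist u v \<le> \<epsilon>"
proof -
  have "\<exists>V. openin (top_of_set X) V \<and> x \<in> V \<and> V \<subseteq> ball x (\<epsilon>/2) \<and>
          finite (top_of_set X frontier_of V)" if "x \<in> X" for x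
  proof -
    have "openin (top_of_set X) (X \<inter> ball x (\<epsilon>/2))" "x \<in> X \<inter> ball x (\<epsilon>/2)"
      using that assms(2) by (auto simp: openin_open_Int)
    moreover have "\<exists>V. openin (top_of_set X) V \<and> x \<in> V \<and> V \<subseteq> U \<and> finite (top_of_set X frontier_of V)"
      if "openin (top_of_set X) U" "x \<in> U" for U
      using assms(1) that \<open>x \<in> X\<close> unfolding regular_curve_def by blast
    ultimately show ?thesis by (metis le_inf_iff)
  qed
  then obtain V where V: "\<And>x. x \<in> X \<Longrightarrow> openin (top_of_set X) (V x)" "\<And>x. x \<in> X \<Longrightarrow> x \<in> V x"
      "\<And>x. x \<in> X \<Longrightarrow> V x \<subseteq> ball x (\<epsilon>/2)" "\<And>x. x \<in> X \<Longrightarrow> finite (top_of_set X frontier_of V x)"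
    by metis
  have "compact X" using assms(1) by (simp add: regular_curve_def continuum_def)
  have "\<exists>\<D>\<subseteq>V ` X. finite \<D> \<and> X \<subseteq> \<Union>\<D>"
  proof -
    have "\<forall>T\<in>V ` X. openin (top_of_set X) T" "X \<subseteq> \<Union>(V ` X)" using V(1,2) by auto
    then show ?thesis using \<open>compact X\<close> unfolding compact_eq_openin_cover by blast
  qed
  then obtain K where K: "finite K" "K \<subseteq> X" "X \<subseteq> (\<Union>x\<in>K. V x)"
    by (metis finite_subset_image)
  define F where "F = (\<Union>x\<in>K. top_of_set X frontier_of V x)"
  show thesis
  proof (rule that)
    show "finite F" unfolding F_def using K V(4) by blast
    show "F \<subseteq> X"
      unfolding F_def using frontier_of_subset_topspace[of "top_of_set X"] by auto
    fix S u v assume S: "connected S" "S \<subseteq> X - F" "u \<in> S" "v \<in> S"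
    then obtain x where x: "x \<in> K" "u \<in> V x" using K(3) by blast
    have "connectedin (top_of_set X) S"
      using S by (auto simp: connectedin_subtopology)
    moreover have "S \<inter> top_of_set X frontier_of V x = {}"
      using S(2) x(1) unfolding F_def by blast
    ultimately have "S \<subseteq> V x"
      using connectedin_Int_frontier_of[of "top_of_set X" S "V x"] S(3) x(2) by blast
    then have "dist x u < \<epsilon>/2" "dist x v < \<epsilon>/2"
      using V(3)[of x] S x K(2) by (auto simp: subset_iff)
    then show "dist u v \<le> \<epsilon>"
      by (metis dist_triangle_half_r less_eq_real_def)
  qed
qed

text \<open>Boundary bumping, in terms of a point: the set \<open>D\<close> is the component of \<open>y\<close> in \<open>C - K\<close>.\<close>

lemma connected_set_bumping_closed:
  fixes C :: "'a::metric_space set"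
  assumes "compact C" "connected C" "closed K" "C \<inter> K \<noteq> {}" "y \<in> C" "y \<notin> K"
  obtains D z where "connected D" "y \<in> D" "D \<subseteq> C - K" "z \<in> closure D" "z \<in> C \<inter> K"
proof -
  let ?T = "top_of_set C" and ?S = "C - K"
  define D where "D = connected_component_of_set (subtopology ?T ?S) y"
  have D: "D \<in> connected_components_of (subtopology ?T ?S)" "y \<in> D"
    using assms unfolding D_def
    by (auto simp: connected_component_in_connected_components_of connected_component_of_refl)
  have "?T frontier_of D \<inter> ?T frontier_of ?S \<noteq> {}"
  proof (rule boundary_bumping_theorem[OF _ _ _ _ D(1)])
    show "?S \<subset> topspace ?T" using assms(4) by auto
  qed (use assms in \<open>auto simp: connectedin_def[symmetric] Hausdorff_space_subtopology
         compact_space_subtopology connected_space_subtopology\<close>)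
  then obtain z where z: "z \<in> ?T frontier_of D" "z \<in> ?T frontier_of ?S" by blast
  have Dsub: "D \<subseteq> C - K"
    using connected_components_of_subset[OF D(1)] by auto
  have conn: "connected D"
    using connectedin_connected_components_of[OF D(1)] by (auto simp: connectedin_subtopology)
  have "openin ?T ?S"
    using assms(3) by (metis Diff_eq openin_open_Int open_Compl)
  then have "z \<notin> ?S"
    using z(2) by (auto simp: frontier_of_def interior_of_openin)
  moreover have "z \<in> C"
    using z(1) frontier_of_subset_topspace[of ?T D] by auto
  moreover have "z \<in> closure D"
    using z(1) by (auto simp: frontier_of_def closure_of_subtopology)
       (metis closure_mono inf_le2 subsetD)
  ultimately show thesis using that[of D z] D(2) Dsub conn by blast
qed

section \<open>Iterates and the components of their fibres\<close>

lemma funpow_mem: "f \<in> X \<rightarrow> X \<Longrightarrow> x \<in> X \<Longrightarrow> (f ^^ k) x \<in> X"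
  by (induction k) auto

lemma continuous_on_funpow:
  assumes "continuous_on X f" "f \<in> X \<rightarrow> X"
  shows "continuous_on X (f ^^ k)"
proof (induction k)
  case (Suc k)
  have "continuous_on X (f \<circ> (f ^^ k))"
    by (rule continuous_on_compose[OF Suc continuous_on_subset[OF assms(1)]])
       (use funpow_mem[OF assms(2)] in auto)
  then show ?case by simp
qed (auto simp: id_def)

lemma funpow_eq_mono:
  fixes f :: "'a \<Rightarrow> 'a"
  assumes "(f ^^ j) x = (f ^^ j) y" "j \<le> l"
  shows "(f ^^ l) x = (f ^^ l) y"
proof -
  have "f ^^ l = f ^^ (l - j) \<circ> f ^^ j"
    using assms(2) by (metis funpow_add le_add_diff_inverse2)
  then show ?thesis using assms(1) by simp
qed

lemma fibre_component_continuum: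
  fixes X :: "'a::metric_space set"
  assumes "compact X" and f: "continuous_on X f" "f \<in> X \<rightarrow> X" and "z \<in> X"
  obtains C where "C \<in> components {x\<in>X. (f ^^ i) x = (f ^^ i) z}"
    "compact C" "connected C" "z \<in> C" "C \<subseteq> X"
    "\<And>j u v. i \<le> j \<Longrightarrow> u \<in> C \<Longrightarrow> v \<in> C \<Longrightarrow> (f ^^ j) u = (f ^^ j) v"
proof -
  define A where "A = X \<inter> (f ^^ i) -` {(f ^^ i) z}"
  have A: "A = {x\<in>X. (f ^^ i) x = (f ^^ i) z}" by (auto simp: A_def)
  have "closed A"
    unfolding A_def using continuous_on_funpow[OF f] compact_imp_closed[OF assms(1)]
    by (intro continuous_closed_preimage) auto
  then have "compact A"
    using compact_Int_closed[OF assms(1), of A] by (simp add: A_def inf_absorb2)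
  have "z \<in> A" using \<open>z \<in> X\<close> by (simp add: A)
  define C where "C = connected_component_set A z"
  have "C \<subseteq> A" unfolding C_def by (rule connected_component_subset)
  show thesis
  proof (rule that[of C])
    show "C \<in> components {x\<in>X. (f ^^ i) x = (f ^^ i) z}"
      using \<open>z \<in> A\<close> unfolding C_def A[symmetric] by (rule componentsI)
    have "closed C" unfolding C_def by (rule closed_connected_component[OF \<open>closed A\<close>])
    then show "compact C"
      using compact_Int_closed[OF \<open>compact A\<close>, of C] \<open>C \<subseteq> A\<close> by (simp add: inf_absorb2)
    show "(f ^^ j) u = (f ^^ j) v" if "i \<le> j" "u \<in> C" "v \<in> C" for j u v
    proof (rule funpow_eq_mono[OF _ that(1)])
      have "u \<in> A" "v \<in> A" using that(2,3) \<open>C \<subseteq> A\<close> by auto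
      then show "(f ^^ i) u = (f ^^ i) v" by (simp add: A)
    qed
    show "connected C" unfolding C_def by (rule connected_connected_component)
    show "z \<in> C" unfolding C_def using \<open>z \<in> A\<close> by simp
    show "C \<subseteq> X" using \<open>C \<subseteq> A\<close> A_def by blast
  qed
qed

section \<open>Shadowing by representatives of fibre components\<close>

text \<open>The induction on \<open>k\<close> needs the statement for a continuum \<open>C\<close> on which only the times before
  \<open>k\<close> are still undecided: the whole space if \<open>k = n\<close>, and a component of a fibre of \<open>f ^^ k\<close> if
  \<open>k < n\<close>. Orbits are compared through the components of \<open>X - F\<close> and not through distances, because
  lying in the same component is transitive. Thus the constant does not grow with the depth of the
  recursion. The closure is needed because the point that is reached by bumping is in \<open>F\<close> at one of
  these times, and may be there again later.\<close>

lemma shadowing_within_continuum: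
  fixes X :: "'a::metric_space set"
  assumes X: "compact X" and f: "continuous_on X f" "f \<in> X \<rightarrow> X" and F: "closed F"
    and R: "\<And>k p C. m \<le> k \<Longrightarrow> k < n \<Longrightarrow> p \<in> F \<Longrightarrow>
              C \<in> components {x\<in>X. (f ^^ k) x = p} \<Longrightarrow> R \<inter> C \<noteq> {}"
    and "k \<le> n" and C: "compact C" "connected C" "C \<subseteq> X" "R \<inter> C \<noteq> {}"
    and const: "\<And>j u v. k \<le> j \<Longrightarrow> j < n \<Longrightarrow> u \<in> C \<Longrightarrow> v \<in> C \<Longrightarrow> (f ^^ j) u = (f ^^ j) v"
    and y: "y \<in> C" "\<And>j. m \<le> j \<Longrightarrow> j < k \<Longrightarrow> (f ^^ j) y \<notin> F"
  shows "\<exists>r\<in>R. (\<forall>j. k \<le> j \<and> j < n \<longrightarrow> (f ^^ j) r = (f ^^ j) y) \<and>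
           (\<forall>j. m \<le> j \<and> j < k \<longrightarrow>
              (f ^^ j) r \<in> closure (connected_component_set (X - F) ((f ^^ j) y)))"
  using \<open>k \<le> n\<close> C const y
proof (induction k arbitrary: C y rule: less_induct)
  case (less k)
  note C = less.prems(2-5) and const = less.prems(6) and y = less.prems(7,8)
  let ?comp = "\<lambda>j u. connected_component_set (X - F) ((f ^^ j) u)"
  have maps: "(f ^^ j) u \<in> X" if "u \<in> X" for j u using funpow_mem[OF f(2) that] .
  have cont: "continuous_on X (f ^^ j)" for j by (rule continuous_on_funpow[OF f])
  have conn_image: "(f ^^ j) ` S \<subseteq> ?comp j u"
    if "connected S" "S \<subseteq> X" "u \<in> S" "\<And>s. s \<in> S \<Longrightarrow> (f ^^ j) s \<notin> F" for j S u
    using that maps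
    by (intro connected_component_maximal connected_continuous_image continuous_on_subset[OF cont]) auto
  \<comment> \<open>Off \<open>K\<close>, connected sets stay in one piece at all undecided times.\<close>
  define K where "K = (\<Union>j\<in>{m..<k}. {x\<in>X. (f ^^ j) x \<in> F})"
  have inK: "u \<in> K \<longleftrightarrow> u \<in> X \<and> (\<exists>j. m \<le> j \<and> j < k \<and> (f ^^ j) u \<in> F)" for u
    by (auto simp: K_def)
  have "closed X" using X by (rule compact_imp_closed)
  have closed_preimage: "closed {x\<in>X. (f ^^ j) x \<in> T}" if "closed T" for j T
    using continuous_closed_preimage[OF cont \<open>closed X\<close> that, of j]
    by (simp add: Collect_conj_eq vimage_def)
  show ?case
  proof (cases "C \<inter> K = {}")
    case True
    obtain r where r: "r \<in> R" "r \<in> C" using C(4) by blast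
    have "(f ^^ j) r \<in> closure (?comp j y)" if "m \<le> j" "j < k" for j
    proof -
      have "(f ^^ j) ` C \<subseteq> ?comp j y"
        using True[unfolded disjoint_iff] that C(3) y(1) by (intro conn_image C) (auto simp: inK)
      then show ?thesis
        using r(2) closure_subset[of "?comp j y"] by (meson image_subset_iff subsetD)
    qed
    then show ?thesis using const[OF _ _ r(2) y(1)] r(1) by (intro bexI[of _ r]) simp_all
  next
    case False
    have "closed K" unfolding K_def using closed_preimage[OF F] by auto
    moreover have "y \<notin> K" using y(2) by (auto simp: inK)
    ultimately obtain D z where D: "connected D" "y \<in> D" "D \<subseteq> C - K" "z \<in> closure D" "z \<in> C \<inter> K"
      using connected_set_bumping_closed[OF C(1,2) _ False y(1)] by blast
    have "\<exists>j. m \<le> j \<and> j < k \<and> (f ^^ j) z \<in> F" and "z \<in> X" using D(5) by (auto simp: inK)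
    \<comment> \<open>Taking the first visit of \<open>z\<close> to \<open>F\<close> makes the induction hypothesis applicable to \<open>z\<close>, and it
      keeps \<open>z\<close> in the pieces of \<open>y\<close> before time \<open>i\<close>.\<close>
    then obtain i where i: "m \<le> i" "i < k" "(f ^^ i) z \<in> F"
        and before: "\<And>j. m \<le> j \<Longrightarrow> j < i \<Longrightarrow> (f ^^ j) z \<notin> F"
      using exists_least_iff[of "\<lambda>j. m \<le> j \<and> j < k \<and> (f ^^ j) z \<in> F"] by (meson less_trans)
    obtain C' where C': "C' \<in> components {x\<in>X. (f ^^ i) x = (f ^^ i) z}"
        "compact C'" "connected C'" "z \<in> C'" "C' \<subseteq> X"
        "\<And>j u v. i \<le> j \<Longrightarrow> u \<in> C' \<Longrightarrow> v \<in> C' \<Longrightarrow> (f ^^ j) u = (f ^^ j) v"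
      using fibre_component_continuum[OF X f \<open>z \<in> X\<close>] by blast
    have meets: "R \<inter> C' \<noteq> {}" using R[OF i(1) _ i(3) C'(1)] i(2) less.prems(1) by simp
    have "i \<le> n" using i(2) less.prems(1) by simp
    have "\<exists>r\<in>R. (\<forall>j. i \<le> j \<and> j < n \<longrightarrow> (f ^^ j) r = (f ^^ j) z) \<and>
        (\<forall>j. m \<le> j \<and> j < i \<longrightarrow> (f ^^ j) r \<in> closure (?comp j z))"
    proof (rule less.IH[OF i(2) \<open>i \<le> n\<close> C'(2,3,5) meets _ C'(4) before])
      show "(f ^^ j) u = (f ^^ j) v" if "i \<le> j" "j < n" "u \<in> C'" "v \<in> C'" for j u v
        by (rule C'(6)[OF that(1,3,4)])
    qed
    then obtain r where r: "r \<in> R" "\<And>j. i \<le> j \<Longrightarrow> j < n \<Longrightarrow> (f ^^ j) r = (f ^^ j) z"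
        "\<And>j. m \<le> j \<Longrightarrow> j < i \<Longrightarrow> (f ^^ j) r \<in> closure (?comp j z)"
      by blast
    have "closure D \<subseteq> C"
      using D(3) C(1) by (metis Diff_subset closure_minimal compact_imp_closed order_trans)
    have "D \<subseteq> X" using D(3) C(3) by blast
    have D_avoids: "(f ^^ j) s \<notin> F" if "m \<le> j" "j < k" "s \<in> D" for j s
    proof -
      have "s \<notin> K" "s \<in> X" using D(3) \<open>D \<subseteq> X\<close> that(3) by auto
      then show ?thesis using that(1,2) by (auto simp: inK)
    qed
    have D_comp: "(f ^^ j) ` D \<subseteq> ?comp j y" if "m \<le> j" "j < k" for j
      using D_avoids[OF that] by (rule conn_image[OF D(1) \<open>D \<subseteq> X\<close> D(2)])
    have "(f ^^ j) r \<in> closure (?comp j y)" if j: "m \<le> j" "j < k" for j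
    proof (cases "j < i")
      case True
      \<comment> \<open>Before time \<open>i\<close>, not even the limit point \<open>z\<close> has met \<open>F\<close>, so it is in the same piece as \<open>y\<close>.\<close>
      have "connected (insert z D)"
        using D(4) closure_subset[of D]
        by (intro connected_intermediate_closure[OF D(1) subset_insertI]) blast
      then have "(f ^^ j) ` insert z D \<subseteq> ?comp j y"
      proof (rule conn_image)
        show "(f ^^ j) s \<notin> F" if "s \<in> insert z D" for s
          using that before[OF j(1) True] D_avoids[OF j, of s] by (elim insertE) simp_all
        show "y \<in> insert z D" using D(2) by simp
        show "insert z D \<subseteq> X" using \<open>D \<subseteq> X\<close> \<open>z \<in> X\<close> by simp
      qed
      then have "(f ^^ j) z \<in> ?comp j y" by (meson image_subset_iff insertI1)
      then have "?comp j z = ?comp j y" by (rule connected_component_eq)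
      then show ?thesis using r(3)[OF j(1) True] by simp
    next
      case False
      \<comment> \<open>From time \<open>i\<close> on, the representative follows \<open>z\<close>, which is a limit of points of \<open>D\<close>.\<close>
      have "(f ^^ j) ` closure D \<subseteq> closure (?comp j y)"
      proof (rule image_closure_subset)
        show "continuous_on (closure D) (f ^^ j)"
          by (rule continuous_on_subset[OF cont order_trans[OF \<open>closure D \<subseteq> C\<close> C(3)]])
        show "(f ^^ j) ` D \<subseteq> closure (?comp j y)"
          by (rule order_trans[OF D_comp[OF j] closure_subset])
      qed simp
      moreover have "(f ^^ j) r = (f ^^ j) z"
        using r(2)[of j] False j(2) less.prems(1) by linarith
      ultimately show ?thesis using D(4) by (simp add: image_subset_iff)
    qed
    moreover have "(f ^^ j) r = (f ^^ j) y" if "k \<le> j" "j < n" for j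
    proof -
      have "(f ^^ j) r = (f ^^ j) z" using r(2)[of j] that i(2) by linarith
      also have "\<dots> = (f ^^ j) y" using const[OF that, of z y] D(5) y(1) by blast
      finally show ?thesis .
    qed
    ultimately show ?thesis by (intro bexI[OF _ r(1)]) simp
  qed
qed

text \<open>A point whose orbit avoids \<open>F\<close> is treated with the whole space as the initial continuum; any
  other point starts from its fibre component at the first visit to \<open>F\<close>.\<close>

lemma shadowing:
  fixes X :: "'a::metric_space set"
  assumes X: "compact X" "connected X" and f: "continuous_on X f" "f \<in> X \<rightarrow> X" and F: "closed F"
    and R: "\<And>k p C. m \<le> k \<Longrightarrow> k < n \<Longrightarrow> p \<in> F \<Longrightarrow>
              C \<in> components {x\<in>X. (f ^^ k) x = p} \<Longrightarrow> R \<inter> C \<noteq> {}"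
    and "R \<inter> X \<noteq> {}" and "x \<in> X"
  shows "\<exists>r\<in>R. \<forall>j. m \<le> j \<and> j < n \<longrightarrow> (f ^^ j) r = (f ^^ j) x \<or>
           (f ^^ j) r \<in> closure (connected_component_set (X - F) ((f ^^ j) x))"
proof (cases "\<exists>k. m \<le> k \<and> k < n \<and> (f ^^ k) x \<in> F")
  case False
  then have "\<exists>r\<in>R. (\<forall>j. n \<le> j \<and> j < n \<longrightarrow> (f ^^ j) r = (f ^^ j) x) \<and>
      (\<forall>j. m \<le> j \<and> j < n \<longrightarrow>
        (f ^^ j) r \<in> closure (connected_component_set (X - F) ((f ^^ j) x)))"
    using assms(8)
    by (intro shadowing_within_continuum[OF X(1) f F R order_refl X order_refl assms(7)]) auto
  then show ?thesis by blast
next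
  case True
  then obtain k where k: "m \<le> k" "k < n" "(f ^^ k) x \<in> F"
      and before: "\<And>j. m \<le> j \<Longrightarrow> j < k \<Longrightarrow> (f ^^ j) x \<notin> F"
    using exists_least_iff[of "\<lambda>j. m \<le> j \<and> j < n \<and> (f ^^ j) x \<in> F"] by (meson less_trans)
  obtain C where C: "C \<in> components {u\<in>X. (f ^^ k) u = (f ^^ k) x}"
      "compact C" "connected C" "x \<in> C" "C \<subseteq> X"
      "\<And>j u v. k \<le> j \<Longrightarrow> u \<in> C \<Longrightarrow> v \<in> C \<Longrightarrow> (f ^^ j) u = (f ^^ j) v"
    using fibre_component_continuum[OF X(1) f \<open>x \<in> X\<close>] by blast
  have "\<exists>r\<in>R. (\<forall>j. k \<le> j \<and> j < n \<longrightarrow> (f ^^ j) r = (f ^^ j) x) \<and>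
      (\<forall>j. m \<le> j \<and> j < k \<longrightarrow>
        (f ^^ j) r \<in> closure (connected_component_set (X - F) ((f ^^ j) x)))"
  proof (rule shadowing_within_continuum[OF X(1) f F R less_imp_le[OF k(2)] C(2,3,5)
            R[OF k(1,2,3) C(1)] _ C(4) before])
    show "(f ^^ j) u = (f ^^ j) v" if "k \<le> j" "j < n" "u \<in> C" "v \<in> C" for j u v
      by (rule C(6)[OF that(1,3,4)])
  qed
  then show ?thesis by (meson not_le_imp_less)
qed

section \<open>Counting separated points\<close>

text \<open>The extra point \<open>x\<close> provides a representative of the space itself, which is needed when all
  these fibres are empty, for instance if \<open>m \<ge> 1\<close> and the image of \<open>f\<close> misses \<open>F\<close>.\<close>

lemma fibre_component_transversal:
  fixes X :: "'a::metric_space set"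
  assumes "finite F" "F \<subseteq> X" and phi: "\<And>k. m \<le> k \<Longrightarrow> k < n \<Longrightarrow> phi X f k \<le> enat N"
  obtains R where "finite R" "x \<in> R" "card R \<le> Suc (n * (card F * N))"
    "\<And>k p C. m \<le> k \<Longrightarrow> k < n \<Longrightarrow> p \<in> F \<Longrightarrow> C \<in> components {y\<in>X. (f ^^ k) y = p} \<Longrightarrow> R \<inter> C \<noteq> {}"
proof -
  define \<C> where "\<C> = (\<lambda>k p. components {y\<in>X. (f ^^ k) y = p})"
  have \<C>: "finite (\<C> k p) \<and> card (\<C> k p) \<le> N" if "k \<in> {m..<n}" "p \<in> F" for k p
  proof -
    have "cardinality (\<C> k p) \<le> phi X f k"
      unfolding phi_def \<C>_def by (rule SUP_upper) (use that assms(2) in auto)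
    also have "\<dots> \<le> enat N" using phi that by simp
    finally show ?thesis by (simp add: cardinality_def split: if_splits)
  qed
  define rep where "rep = (\<lambda>C::'a set. SOME y. y \<in> C)"
  define Q where "Q = (\<Union>k\<in>{m..<n}. \<Union>p\<in>F. rep ` \<C> k p)"
  have "card Q \<le> (\<Sum>k\<in>{m..<n}. card (\<Union>p\<in>F. rep ` \<C> k p))"
    unfolding Q_def by (rule card_UN_le) simp
  also have "\<dots> \<le> (\<Sum>k\<in>{m..<n}. card F * N)"
  proof (rule sum_mono)
    fix k assume k: "k \<in> {m..<n}"
    have "card (\<Union>p\<in>F. rep ` \<C> k p) \<le> (\<Sum>p\<in>F. card (rep ` \<C> k p))"
      by (rule card_UN_le[OF \<open>finite F\<close>])
    also have "\<dots> \<le> (\<Sum>p\<in>F. N)"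
      using \<C>[OF k] by (intro sum_mono) (meson card_image_le order_trans)
    finally show "card (\<Union>p\<in>F. rep ` \<C> k p) \<le> card F * N" by simp
  qed
  also have "\<dots> \<le> n * (card F * N)" by simp
  finally have "card Q \<le> n * (card F * N)" .
  moreover have "finite Q" unfolding Q_def using \<C> \<open>finite F\<close> by blast
  ultimately have Q: "finite (insert x Q)" "card (insert x Q) \<le> Suc (n * (card F * N))"
    by (auto simp: card_insert_if)
  have meets: "insert x Q \<inter> C \<noteq> {}"
    if "m \<le> k" "k < n" "p \<in> F" "C \<in> components {y\<in>X. (f ^^ k) y = p}" for k p C
  proof -
    have "rep C \<in> C"
      unfolding rep_def using in_components_nonempty[OF that(4)] by (simp add: some_in_eq)
    moreover have "C \<in> \<C> k p" "k \<in> {m..<n}" using that by (simp_all add: \<C>_def)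
    then have "rep C \<in> Q" unfolding Q_def using that(3) by (intro UN_I imageI)
    ultimately show ?thesis by blast
  qed
  show thesis by (rule that[OF Q(1) insertI1 Q(2) meets])
qed

text \<open>The separated set is partitioned according to the shadowing representatives. Points of one class
  are within \<open>2 * \<epsilon> < \<delta>\<close> of each other from time \<open>m\<close> on, so they have to be separated before \<open>m\<close>.\<close>

lemma card_separated_le_transversal:
  fixes X :: "'a::metric_space set"
  assumes X: "compact X" "connected X" and f: "continuous_on X f" "f \<in> X \<rightarrow> X" and "finite F"
    and cut: "\<And>S u v. connected S \<Longrightarrow> S \<subseteq> X - F \<Longrightarrow> u \<in> S \<Longrightarrow> v \<in> S \<Longrightarrow> dist u v \<le> \<epsilon>"
    and "\<epsilon> \<ge> 0" "2 * \<epsilon> < \<delta>" and "1 \<le> m" "m \<le> n"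
    and "finite R" "R \<inter> X \<noteq> {}"
    and R: "\<And>k p C. m \<le> k \<Longrightarrow> k < n \<Longrightarrow> p \<in> F \<Longrightarrow>
              C \<in> components {x\<in>X. (f ^^ k) x = p} \<Longrightarrow> R \<inter> C \<noteq> {}"
    and M: "\<And>E. E \<subseteq> X \<Longrightarrow> separated f m \<delta> E \<Longrightarrow> card E \<le> M"
    and E: "E \<subseteq> X" "separated f n \<delta> E"
  shows "card E \<le> card R * M"
proof -
  have "\<exists>r\<in>R. \<forall>j. m \<le> j \<and> j < n \<longrightarrow> dist ((f ^^ j) x) ((f ^^ j) r) \<le> \<epsilon>" if "x \<in> X" for x
  proof -
    have "\<exists>r\<in>R. \<forall>j. m \<le> j \<and> j < n \<longrightarrow> (f ^^ j) r = (f ^^ j) x \<or>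
        (f ^^ j) r \<in> closure (connected_component_set (X - F) ((f ^^ j) x))"
      by (rule shadowing[OF X f finite_imp_closed[OF \<open>finite F\<close>] R \<open>R \<inter> X \<noteq> {}\<close> \<open>x \<in> X\<close>])
    then obtain r where r: "r \<in> R" "\<And>j. m \<le> j \<Longrightarrow> j < n \<Longrightarrow> (f ^^ j) r = (f ^^ j) x \<or>
        (f ^^ j) r \<in> closure (connected_component_set (X - F) ((f ^^ j) x))"
      by (elim bexE) simp
    have "dist ((f ^^ j) x) ((f ^^ j) r) \<le> \<epsilon>" if j: "m \<le> j" "j < n" for j
    proof (cases "(f ^^ j) r = (f ^^ j) x")
      case True
      then show ?thesis using \<open>\<epsilon> \<ge> 0\<close> by simp
    next
      case False
      \<comment> \<open>If \<open>(f ^^ j) x\<close> were in \<open>F\<close>, the component set and its closure would be empty.\<close>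
      define S where "S = connected_component_set (X - F) ((f ^^ j) x)"
      have rS: "(f ^^ j) r \<in> closure S" using r(2)[OF j] False by (simp add: S_def)
      then have "S \<noteq> {}" by auto
      then have "(f ^^ j) x \<in> X - F"
        unfolding S_def using connected_component_eq_empty by metis
      then have "(f ^^ j) x \<in> S" by (simp add: S_def)
      then have "S \<subseteq> cball ((f ^^ j) x) \<epsilon>"
        using cut[of S "(f ^^ j) x"] connected_component_subset[of "X - F" "(f ^^ j) x"]
        by (auto simp: S_def)
      then have "closure S \<subseteq> cball ((f ^^ j) x) \<epsilon>" by (rule closure_minimal) simp
      with rS show ?thesis by auto
    qed
    with r(1) show ?thesis by blast
  qed
  then obtain \<rho> where \<rho>: "\<And>x. x \<in> X \<Longrightarrow> \<rho> x \<in> R"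
      "\<And>x j. x \<in> X \<Longrightarrow> m \<le> j \<Longrightarrow> j < n \<Longrightarrow> dist ((f ^^ j) x) ((f ^^ j) (\<rho> x)) \<le> \<epsilon>"
    by metis
  have ne: "{..<k} \<noteq> {}" if "m \<le> k" for k using that \<open>1 \<le> m\<close> by (auto simp: lessThan_empty_iff)
  have class_le: "card {x\<in>E. \<rho> x = r} \<le> M" for r
  proof (rule M)
    show "{x\<in>E. \<rho> x = r} \<subseteq> X" using E(1) by blast
    show "separated f m \<delta> {x\<in>E. \<rho> x = r}"
      unfolding separated_def
    proof (intro conjI ballI impI)
      show "finite {x\<in>E. \<rho> x = r}" using E(2) by (simp add: separated_def)
      fix x y assume xy: "x \<in> {x\<in>E. \<rho> x = r}" "y \<in> {x\<in>E. \<rho> x = r}" "x \<noteq> y"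
      then have "\<delta> \<le> bowen_dist f n x y" using E(2) by (simp add: separated_def)
      then obtain j where j: "j < n" "\<delta> \<le> dist ((f ^^ j) x) ((f ^^ j) y)"
        unfolding bowen_dist_def using ne[OF \<open>m \<le> n\<close>] by (subst (asm) Max_ge_iff) auto
      have "j < m"
      proof (rule ccontr)
        assume "\<not> j < m"
        then have "dist ((f ^^ j) x) ((f ^^ j) r) \<le> \<epsilon>" "dist ((f ^^ j) y) ((f ^^ j) r) \<le> \<epsilon>"
          using \<rho>(2)[of x j] \<rho>(2)[of y j] xy E(1) j(1) by auto
        then show False
          using j(2) \<open>2 * \<epsilon> < \<delta>\<close> dist_triangle2[of "(f ^^ j) x" "(f ^^ j) y" "(f ^^ j) r"] by simp
      qed
      then show "\<delta> \<le> bowen_dist f m x y"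
        unfolding bowen_dist_def using j(2) ne[of m] by (subst Max_ge_iff) auto
    qed
  qed
  have "E = (\<Union>r\<in>R. {x\<in>E. \<rho> x = r})" using \<rho>(1) E(1) by auto
  then have "card E \<le> (\<Sum>r\<in>R. card {x\<in>E. \<rho> x = r})"
    using card_UN_le[OF \<open>finite R\<close>] by metis
  also have "\<dots> \<le> card R * M"
    using sum_bounded_above[of R "\<lambda>r. card {x\<in>E. \<rho> x = r}" M] class_le by simp
  finally show ?thesis .
qed

section \<open>Growth rates\<close>

lemma growth_rate_le_powr:
  assumes "K > 0" and "\<forall>\<^sub>F n in sequentially. \<exists>b. a n \<le> enat b \<and> real b \<le> K * real n powr s"
  shows "growth_rate a \<le> ereal s"
proof -
  have "(\<lambda>n. ln K / ln (real n)) \<longlonglongrightarrow> 0"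
    by (intro tendsto_divide_0[OF tendsto_const] filterlim_at_top_imp_at_infinity
        filterlim_compose[OF ln_at_top filterlim_real_sequentially])
  then have "(\<lambda>n. ln K / ln (real n) + s) \<longlonglongrightarrow> 0 + s"
    by (rule tendsto_add[OF _ tendsto_const])
  then have "(\<lambda>n. ereal (ln K / ln (real n) + s)) \<longlonglongrightarrow> ereal s" by simp
  then have lim: "limsup (\<lambda>n. ereal (ln K / ln (real n) + s)) = ereal s"
    by (intro lim_imp_Limsup) auto
  have "growth_rate a \<le> limsup (\<lambda>n. ereal (ln K / ln (real n) + s))"
    unfolding growth_rate_def
  proof (rule Limsup_mono)
    show "\<forall>\<^sub>F n in sequentially. ln_enat (a n) / ereal (ln (real n)) \<le> ereal (ln K / ln (real n) + s)"
      using assms(2) eventually_gt_at_top[of 1]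
    proof eventually_elim
      case (elim n)
      then obtain b where b: "a n \<le> enat b" "real b \<le> K * real n powr s" by blast
      have pos: "ln (real n) > 0" using elim(2) by simp
      have "ln_enat (enat b) \<le> ereal (ln K + s * ln (real n))"
      proof (cases "b = 0")
        case False
        then have "ln (real b) \<le> ln (K * real n powr s)"
          using b(2) by (intro ln_mono) auto
        then show ?thesis
          using False \<open>K > 0\<close> elim(2) by (simp add: ln_enat_def ln_mult ln_powr)
      qed (simp add: ln_enat_def)
      then have "ln_enat (a n) \<le> ereal (ln K + s * ln (real n))"
        using ln_enat_mono[OF b(1)] by (rule order_trans[rotated])
      then have "ln_enat (a n) / ereal (ln (real n)) \<le> ereal (ln K + s * ln (real n)) / ereal (ln (real n))"
        using pos by (intro ereal_divide_right_mono) auto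
      also have "\<dots> = ereal (ln K / ln (real n) + s)"
        using pos by (simp add: add_divide_distrib)
      finally show ?case .
    qed
  qed
  with lim show ?thesis by simp
qed

lemma eventually_le_powr_of_growth_rate:
  assumes "growth_rate a < ereal s"
  shows "\<forall>\<^sub>F n in sequentially. \<exists>b. a n = enat b \<and> real b \<le> real n powr s"
  using Limsup_lessD[OF assms[unfolded growth_rate_def]] eventually_gt_at_top[of 1]
proof eventually_elim
  case (elim n)
  have pos: "ln (real n) > 0" using elim(2) by simp
  have "ln_enat \<infinity> / ereal (ln (real n)) = \<infinity>" using pos by (simp add: ln_enat_def)
  then obtain b where b: "a n = enat b" using elim(1) by (cases "a n") auto
  have "real b \<le> real n powr s"
  proof (cases "b = 0")
    case False
    then have "ln (real b) < s * ln (real n)"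
      using elim(1) pos b by (simp add: ln_enat_def divide_less_eq)
    then have "exp (ln (real b)) \<le> exp (s * ln (real n))" by simp
    then show ?thesis using False elim(2) by (simp add: powr_def)
  qed simp
  with b show ?case by blast
qed

lemma one_le_phi:
  assumes "x \<in> X" "f \<in> X \<rightarrow> X"
  shows "1 \<le> phi X f n"
proof -
  let ?A = "{y\<in>X. (f ^^ n) y = (f ^^ n) x}"
  have "components ?A \<noteq> {}" using assms(1) by (auto simp: components_eq_empty)
  then have "1 \<le> cardinality (components ?A)"
    by (auto simp: cardinality_def one_enat_def Suc_le_eq card_gt_0_iff)
  also have "\<dots> \<le> phi X f n"
    unfolding phi_def using funpow_mem[OF assms(2,1)] by (rule SUP_upper)
  finally show ?thesis .
qed

text \<open>Only a nonnegative exponent \<open>s\<close> makes \<open>k powr s\<close> monotone in \<open>k\<close>, so that one bound serves all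
  times \<open>k < n\<close> below. This lemma ensures that every exponent above the growth rate is of this kind.\<close>

lemma growth_rate_phi_nonneg:
  assumes "X \<noteq> {}" "f \<in> X \<rightarrow> X"
  shows "0 \<le> growth_rate (phi X f)"
proof -
  obtain x where x: "x \<in> X" using assms(1) by blast
  have "\<forall>\<^sub>F n in sequentially. 0 \<le> ln_enat (phi X f n) / ereal (ln (real n))"
    using eventually_gt_at_top[of 1]
  proof eventually_elim
    case (elim n)
    have "0 = ln_enat 1" by (simp add: ln_enat_def one_enat_def)
    also have "\<dots> \<le> ln_enat (phi X f n)" by (rule ln_enat_mono[OF one_le_phi[OF x assms(2)]])
    finally show ?case using elim by (intro zero_le_divide_ereal) auto
  qed
  then show ?thesis
    unfolding growth_rate_def by (intro le_Limsup) auto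
qed

text \<open>The summand \<open>1\<close> in the exponent comes from the number of times at which fibres are taken; the
  finite set \<open>F\<close> and the bound for the times before \<open>m\<close> contribute only to the constant.\<close>

lemma growth_rate_sep_le:
  fixes X :: "'a::metric_space set"
  assumes rc: "regular_curve X" and f: "continuous_on X f" "f \<in> X \<rightarrow> X"
    and "\<delta> > 0" "0 \<le> s" "growth_rate (phi X f) < ereal s"
  shows "growth_rate (\<lambda>n. sep X f n \<delta>) \<le> ereal (1 + s)"
proof -
  have X: "compact X" "connected X" "X \<noteq> {}"
    using rc by (auto simp: regular_curve_def continuum_def)
  then obtain x where "x \<in> X" by blast
  obtain F where F: "finite F" "F \<subseteq> X"
    "\<And>S u v. connected S \<Longrightarrow> S \<subseteq> X - F \<Longrightarrow> u \<in> S \<Longrightarrow> v \<in> S \<Longrightarrow> dist u v \<le> \<delta> / 3"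
    using regular_curve_finite_cut[OF rc, of "\<delta>/3"] \<open>\<delta> > 0\<close> by auto
  obtain m where m: "1 \<le> m" "\<And>k. m \<le> k \<Longrightarrow> \<exists>b. phi X f k = enat b \<and> real b \<le> real k powr s"
  proof -
    have "\<forall>\<^sub>F k in sequentially. 1 \<le> k \<and> (\<exists>b. phi X f k = enat b \<and> real b \<le> real k powr s)"
      using eventually_le_powr_of_growth_rate[OF assms(6)] eventually_ge_at_top[of 1]
      by eventually_elim simp
    then show thesis using that unfolding eventually_sequentially by blast
  qed
  obtain M where M: "\<And>E. E \<subseteq> X \<Longrightarrow> separated f m \<delta> E \<Longrightarrow> card E \<le> M"
  proof -
    obtain E0 :: "'a set" where "sep X f m \<delta> = enat (card E0)"
      using sep_is_max[OF X(1) f m(1) \<open>\<delta> > 0\<close>] by blast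
    then have "card E \<le> card E0" if "E \<subseteq> X" "separated f m \<delta> E" for E
      using that SUP_upper[of E "{E. E \<subseteq> X \<and> separated f m \<delta> E}" "\<lambda>E. enat (card E)"]
      by (simp add: sep_def)
    then show thesis by (rule that)
  qed
  define K where "K = (1 + real (card F)) * (1 + real M)"
  have "\<exists>b. sep X f n \<delta> \<le> enat b \<and> real b \<le> K * real n powr (1 + s)" if "m \<le> n" for n
  proof -
    define N where "N = nat \<lfloor>real n powr s\<rfloor>"
    have "phi X f k \<le> enat N" if "m \<le> k" "k < n" for k
    proof -
      obtain b where b: "phi X f k = enat b" "real b \<le> real k powr s" using m(2) \<open>m \<le> k\<close> by blast
      note b(2)
      also have "real k powr s \<le> real n powr s" using that \<open>0 \<le> s\<close> by (intro powr_mono2) auto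
      finally show ?thesis using b(1) by (simp add: N_def le_nat_floor)
    qed
    then obtain R where R: "finite R" "x \<in> R" "card R \<le> Suc (n * (card F * N))"
        "\<And>k p C. m \<le> k \<Longrightarrow> k < n \<Longrightarrow> p \<in> F \<Longrightarrow> C \<in> components {y\<in>X. (f ^^ k) y = p} \<Longrightarrow> R \<inter> C \<noteq> {}"
      using fibre_component_transversal[OF F(1,2), where m = m and n = n and f = f and N = N and x = x] by blast
    have "R \<inter> X \<noteq> {}" using R(2) \<open>x \<in> X\<close> by blast
    have "card E \<le> card R * M" if "E \<subseteq> X" "separated f n \<delta> E" for E
      by (rule card_separated_le_transversal[OF X(1,2) f F(1,3) _ _ m(1) \<open>m \<le> n\<close> R(1)
            \<open>R \<inter> X \<noteq> {}\<close> R(4) M that]) (use \<open>\<delta> > 0\<close> in auto)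
    then have "sep X f n \<delta> \<le> enat (card R * M)"
      unfolding sep_def by (intro SUP_least) auto
    moreover have "real (card R * M) \<le> K * real n powr (1 + s)"
    proof -
      have n: "1 \<le> real n" using m(1) \<open>m \<le> n\<close> by simp
      have "real N \<le> real n powr s" unfolding N_def by (simp add: of_nat_floor)
      then have nN: "real n * real N \<le> real n powr (1 + s)"
        using n by (simp add: powr_add mult_left_mono)
      have one: "1 \<le> real n powr (1 + s)" using n \<open>0 \<le> s\<close> by (intro ge_one_powr_ge_zero) auto
      have "real (card R) \<le> real (Suc (n * (card F * N)))" using R(3) by (rule of_nat_mono)
      also have "\<dots> = 1 + real (card F) * (real n * real N)" by simp
      also have "\<dots> \<le> (1 + real (card F)) * real n powr (1 + s)"
        using one mult_left_mono[OF nN, of "real (card F)"] by (simp add: distrib_right)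
      finally have "real (card R) * real M \<le> (1 + real (card F)) * real n powr (1 + s) * (1 + real M)"
        by (intro mult_mono) auto
      then show ?thesis by (simp add: K_def mult_ac)
    qed
    ultimately show ?thesis by blast
  qed
  then have "\<forall>\<^sub>F n in sequentially. \<exists>b. sep X f n \<delta> \<le> enat b \<and> real b \<le> K * real n powr (1 + s)"
    by (rule eventually_mono[OF eventually_ge_at_top])
  moreover have "K > 0" by (auto simp: K_def intro!: mult_pos_pos add_pos_nonneg)
  ultimately show ?thesis by (intro growth_rate_le_powr)
qed

theorem theorem3:
  fixes X :: "'a::metric_space set" and f :: "'a \<Rightarrow> 'a"
  assumes "regular_curve X"
    and "continuous_on X f" and "f \<in> X \<rightarrow> X"
  shows "pol_entropy X f \<le> 1 + limsup (\<lambda>n. ln_enat (phi X f n) / ereal (ln (real n)))"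
proof -
  define L where "L = growth_rate (phi X f)"
  have "0 \<le> L"
    unfolding L_def using assms(1,3)
    by (intro growth_rate_phi_nonneg) (auto simp: regular_curve_def continuum_def)
  have bound: "pol_entropy X f \<le> ereal (1 + s)" if "L < ereal s" for s
  proof -
    have "0 \<le> s" using \<open>0 \<le> L\<close> that by (metis ereal_less_eq(5) less_imp_le order_trans)
    then have "growth_rate (\<lambda>n. sep X f n \<delta>) \<le> ereal (1 + s)" if "\<delta> > 0" for \<delta>
      using growth_rate_sep_le[OF assms that _ \<open>L < ereal s\<close>[unfolded L_def]] by blast
    then show ?thesis
      by (intro tendsto_upperbound[OF pol_entropy_tendsto] eventually_at_rightI[of 0 1]) auto
  qed
  have "pol_entropy X f \<le> 1 + L"
  proof (cases L)
    case (real l)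
    show ?thesis
    proof (rule ereal_le_epsilon2)
      fix e :: real assume "0 < e"
      then show "pol_entropy X f \<le> 1 + L + ereal e"
        using bound[of "l + e"] real by (simp add: one_ereal_def add.assoc)
    qed
  qed (use \<open>0 \<le> L\<close> in auto)
  then show ?thesis unfolding L_def growth_rate_def .
qed

end
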